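(* Let $\mathbf{E}$ be a Euclidean space, $D\subset\mathbf{E}$, let $T:D\rightrightarrows\mathbf{E}$ be a multi-valued mapping, $S\subset\operatorname{Fix}T$, and $U\subset D$. If (a) $T$ is $(S,\varepsilon)$-firmly nonexpansive on $U$, and (b) for some $\lambda>0$, $T$ satisfies the coercivity condition $$\|x-x_+\|\ge\lambda\,d(x,S)\qquad\forall x_+\in Tx,\ \forall x\in U,$$ then $$d(x_+,S)\le\sqrt{1+\varepsilon-\lambda^2}\;d(x,S)\qquad\forall x_+\in Tx,\ \forall x\in U.$$
   Context: $\mathbf{E}$ is a (finite-dimensional) Euclidean space and $d(x,S)=\inf_{y\in S}\|x-y\|$. For a multi-valued mapping $T$, $\operatorname{Fix}T=\{x\in D: x\in Tx\}$. For nonempty $S$ and $\varepsilon\ge0$, $T$ is called $(S,\varepsilon)$-firmly nonexpansive on $U$ if $$\|x_+-\bar x_+\|^2+\|(x-x_+)-(\bar x-\bar x_+)\|^2\le(1+\varepsilon)\|x-\bar x\|^2$$ for all $x\in U$, $\bar x\in S$, $x_+\in Tx$, $\bar x_+\in T\bar x$. *)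

theory Defs
  imports "HOL-Analysis.Analysis"
begin

text \<open>A multi-valued mapping with domain \<open>D\<close> is a function \<open>T\<close> into sets, of which only the values
  on \<open>D\<close> matter; values may be empty. The distance to a nonempty set is \<^const>\<open>infdist\<close>.\<close>

definition Fix :: "'a set \<Rightarrow> ('a \<Rightarrow> 'a set) \<Rightarrow> 'a set" where
  "Fix D T = {x \<in> D. x \<in> T x}"

definition firmly_nonexpansive_on ::
  "('a::real_normed_vector \<Rightarrow> 'a set) \<Rightarrow> 'a set \<Rightarrow> real \<Rightarrow> 'a set \<Rightarrow> bool" where
  "firmly_nonexpansive_on T S \<epsilon> U \<longleftrightarrow>
     (\<forall>x\<in>U. \<forall>y\<in>S. \<forall>x'\<in>T x. \<forall>y'\<in>T y.
        (norm (x' - y'))\<^sup>2 + (norm ((x - x') - (y - y')))\<^sup>2 \<le> (1 + \<epsilon>) * (norm (x - y))\<^sup>2)"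

end

theory Submission
  imports Defs
begin

text \<open>Each \<open>y\<close> in \<open>S\<close> is one of its own images, so firm
  nonexpansiveness, tested with \<open>y' = y\<close>, gives \<open>norm (x' - y)^2 + norm (x -
  x')^2 \<le> (1 + \<epsilon>) * norm (x - y)^2\<close>. The left side is at least
  \<open>d'^2 + (lam * d)^2\<close>, by the definition of distance and by coercivity, and this bound
  does not depend on \<open>y\<close>. Taking the infimum over \<open>y\<close> on the right and
  rearranging gives the claim; an infimum replaces a nearest point because \<open>S\<close> need not
  be closed.\<close>

lemma infdist_greatest:
  assumes "S \<noteq> {}" and "\<And>y. y \<in> S \<Longrightarrow> r \<le> dist x y"
  shows "r \<le> infdist x S"
  using assms by (simp add: infdist_notempty cINF_greatest)

theorem lemma25:
  fixes D S U :: "'a::euclidean_space set"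
    and T :: "'a \<Rightarrow> 'a set"
    and \<epsilon> lam :: real
  assumes "S \<noteq> {}" and "S \<subseteq> Fix D T" and "U \<subseteq> D" and "\<epsilon> \<ge> 0"
    and "firmly_nonexpansive_on T S \<epsilon> U"
    and "lam > 0"
    and "\<forall>x\<in>U. \<forall>x'\<in>T x. norm (x - x') \<ge> lam * infdist x S"
  shows "\<forall>x\<in>U. \<forall>x'\<in>T x. infdist x' S \<le> sqrt (1 + \<epsilon> - lam\<^sup>2) * infdist x S"
proof (intro ballI)
  fix x x' assume x: "x \<in> U" and x': "x' \<in> T x"
  define d where "d = infdist x S"
  define d' where "d' = infdist x' S"
  \<comment> \<open>The uniform lower bound for the squared distances from \<open>x\<close> to
    points of \<open>S\<close>; its root can be compared with \<open>infdist\<close>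
    directly.\<close>
  define c where "c = (d'\<^sup>2 + (lam * d)\<^sup>2) / (1 + \<epsilon>)"
  have d: "d \<ge> 0" and d': "d' \<ge> 0"
    by (simp_all add: d_def d'_def infdist_nonneg)
  have "sqrt c \<le> dist x y" if y: "y \<in> S" for y
  proof -
    have "y \<in> T y"
      using y \<open>S \<subseteq> Fix D T\<close> by (auto simp: Fix_def)
    then have "(norm (x' - y))\<^sup>2 + (norm (x - x'))\<^sup>2 \<le> (1 + \<epsilon>) * (norm (x - y))\<^sup>2"
      using assms(5) x x' y unfolding firmly_nonexpansive_on_def by fastforce
    moreover have "d'\<^sup>2 \<le> (norm (x' - y))\<^sup>2"
      using d' infdist_le[OF y, of x'] by (intro power_mono) (simp_all add: d'_def dist_norm)
    moreover have "(lam * d)\<^sup>2 \<le> (norm (x - x'))\<^sup>2"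
      using assms(6,7) d x x' by (intro power_mono) (auto simp: d_def)
    ultimately have "c \<le> (dist x y)\<^sup>2"
      using \<open>\<epsilon> \<ge> 0\<close> by (simp add: c_def dist_norm divide_le_eq mult.commute)
    then show ?thesis
      by (simp add: real_le_lsqrt)
  qed
  then have "sqrt c \<le> d"
    unfolding d_def using \<open>S \<noteq> {}\<close> by (rule infdist_greatest[rotated])
  then have "c \<le> d\<^sup>2"
    by (rule sqrt_le_D)
  then have bound: "d'\<^sup>2 \<le> (1 + \<epsilon> - lam\<^sup>2) * d\<^sup>2"
    using \<open>\<epsilon> \<ge> 0\<close> by (simp add: c_def divide_le_eq algebra_simps)
  \<comment> \<open>A negative factor needs no separate case: \<open>bound\<close> then forces
    \<open>d = d' = 0\<close>, and \<open>sqrt\<close> is multiplicative on all reals.\<close>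
  have "d' \<le> sqrt ((1 + \<epsilon> - lam\<^sup>2) * d\<^sup>2)"
    using bound by (rule real_le_rsqrt)
  then show "infdist x' S \<le> sqrt (1 + \<epsilon> - lam\<^sup>2) * infdist x S"
    using d by (simp add: real_sqrt_mult d_def d'_def)
qed

end
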